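(* For the MP-FQI algorithm (described in the context), with $n$ samples and $p$ features, disregarding the complexity of the maximization over $u^+$ for computing $G_{\mathrm{s}}$, the compilation time complexity and the per-iteration time complexity are both of $\mathcal{O}(np)$.
   Context: Notation: $\underline{\mathbb{R}}=\mathbb{R}\cup\{-\infty\}$ with the usual conventions; $[1:n]=\{1,\dots,n\}$; $[v]_i$ and $[M]_{i,j}$ denote entries. For $A\in\underline{\mathbb{R}}^{n\times m}$, $B\in\underline{\mathbb{R}}^{m\times p}$, the max-plus product $A\boxtimes B$ has entries $[A\boxtimes B]_{i,j}=\max_{k\in[1:m]}\{[A]_{i,k}+[B]_{k,j}\}$ (vectors are one-column matrices). Setting: $\mathsf{Z}=\mathsf{X}\times\mathsf{U}$ where $\mathsf{X}\subset\mathbb{R}^{d_{\mathrm{x}}}$, $\mathsf{U}\subset\mathbb{R}^{d_{\mathrm{u}}}$ are nonempty state and action spaces; $\gamma\in(0,1)$ is the discount factor. Data: samples $\{z_i=(x_i,u_i),x_i^+,r_i\}_{i\in[1:n]}$ with $z_i\in\mathsf{Z}$, $x_i^+\in\mathsf{X}$, $r_i\in\mathbb{R}$, and features $f:\mathsf{Z}\to\underline{\mathbb{R}}^p$. The empirical Bellman operator is $\mathbf{B}_{\mathrm{s}}Q(z_i)=r_i+\gamma\max_{u^+\in\mathsf{U}}Q(x_i^+,u^+)$; the maxima over $u^+$ of the features are assumed to exist in $\underline{\mathbb{R}}$. MP-FQI algorithm. Input: samples, $\gamma$, features $f$, termination constant $\epsilon>0$. Compilation: compute $F_{\mathrm{s}},G_{\mathrm{s}}\in\underline{\mathbb{R}}^{n\times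 p}$ with entries $[F_{\mathrm{s}}]_{i,j}=[f]_j(z_i)$, $[G_{\mathrm{s}}]_{i,j}=\mathbf{B}_{\mathrm{s}}[f]_j(z_i)$. Initialize $\theta\leftarrow(0,\dots,0)^\top\in\mathbb{R}^p$ and $\theta^+\leftarrow\mathbf{D}\theta$, where $\mathbf{D}\theta=-[F_{\mathrm{s}}^{\top}\boxtimes[-(G_{\mathrm{s}}\boxtimes(\gamma\theta))]]$. Iterations: while $\|\theta^+-\theta\|_\infty>\epsilon$, set $\theta\leftarrow\theta^+$ and $\theta^+\leftarrow\mathbf{D}\theta$. Output $\theta^+$. Cost model: the time complexity counts elementary operations (additions, multiplications, negations, comparisons/maxima of two numbers), with each evaluation of a feature at a point, and each value $\max_{u^+}[f]_j(x_i^+,u^+)$ (whose maximization cost is disregarded), counted as a unit-cost operation. Max-plus matrix-vector products are computed directly from the definition. *)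

theory Defs
  imports "HOL-Analysis.Analysis" "HOL-Library.Monad_Syntax"
begin

section \<open>Computations with an operation count\<close>

text \<open>
  A value of type \<open>'a timed\<close> is the result of a computation together with the number of
  elementary operations performed to obtain it. Only \<^emph>\<open>elem\<close> charges anything; data movement
  (indexing, transposing, copying a vector) is free.
\<close>

datatype 'a timed = Timed (val: 'a) (cost: nat)

definition ret :: "'a \<Rightarrow> 'a timed" where
  "ret x = Timed x 0"

definition elem :: "'a \<Rightarrow> 'a timed" where
  "elem x = Timed x 1"

definition bind_timed :: "'a timed \<Rightarrow> ('a \<Rightarrow> 'b timed) \<Rightarrow> 'b timed" where
  "bind_timed m k = Timed (val (k (val m))) (cost m + cost (k (val m)))"

adhoc_overloading Monad_Syntax.bind \<rightleftharpoons> bind_timed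

primrec mapT :: "('a \<Rightarrow> 'b timed) \<Rightarrow> 'a list \<Rightarrow> 'b list timed" where
  "mapT g [] = ret []"
| "mapT g (x # xs) = do { y \<leftarrow> g x; ys \<leftarrow> mapT g xs; ret (y # ys) }"

section \<open>Max-plus arithmetic\<close>

text \<open>
  The max-plus numbers are the elements of \<^typ>\<open>ereal\<close> other than \<open>\<infinity>\<close>. Negating \<open>-\<infinity>\<close> leaves this
  set, so the algorithm is run on all of \<^typ>\<open>ereal\<close>; the max-plus convention that \<open>-\<infinity>\<close> is
  absorbing for addition is kept there, whereas \<open>-\<infinity> + \<infinity> = \<infinity>\<close> in \<^typ>\<open>ereal\<close>.
\<close>

definition mplus :: "ereal \<Rightarrow> ereal \<Rightarrow> ereal" (infixl \<open>\<boxplus>\<close> 65) where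
  "x \<boxplus> y = (if x = -\<infinity> \<or> y = -\<infinity> then -\<infinity> else x + y)"

text \<open>Vectors are lists, matrices are lists of rows; indices start at 0.\<close>

type_synonym mvec = "ereal list"
type_synonym mmat = "ereal list list"

definition mp_mult :: "mmat \<Rightarrow> mvec \<Rightarrow> mvec" (infixr \<open>\<boxtimes>\<close> 70) where
  "A \<boxtimes> v = map (\<lambda>a. MAX k\<in>{..<length v}. a ! k \<boxplus> v ! k) A"

fun maxT :: "mvec \<Rightarrow> ereal timed" where
  "maxT [] = ret (-\<infinity>)"
| "maxT [x] = ret x"
| "maxT (x # y # ys) = do { m \<leftarrow> maxT (y # ys); elem (max x m) }"

definition mp_multT :: "mmat \<Rightarrow> mvec \<Rightarrow> mvec timed" where
  "mp_multT A v =
    mapT (\<lambda>a. do { s \<leftarrow> mapT (\<lambda>(x, y). elem (x \<boxplus> y)) (zip a v); maxT s }) A"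

section \<open>The algorithm\<close>

text \<open>A sample is \<open>((x, u), x\<^sup>+, r)\<close>; \<open>f j\<close> is the \<open>j\<close>-th component of the feature map.\<close>

type_synonym ('x, 'u) sample = "('x \<times> 'u) \<times> 'x \<times> real"
type_synonym ('x, 'u) features = "nat \<Rightarrow> 'x \<times> 'u \<Rightarrow> ereal"

definition max_action :: "'u set \<Rightarrow> ('x \<times> 'u \<Rightarrow> ereal) \<Rightarrow> 'x \<Rightarrow> ereal" where
  "max_action U Q x = (GREATEST m. m \<in> (\<lambda>u. Q (x, u)) ` U)"

definition mpfqi_input ::
  "'x set \<Rightarrow> 'u set \<Rightarrow> nat \<Rightarrow> nat \<Rightarrow> ('x, 'u) sample list \<Rightarrow> real \<Rightarrow> ('x, 'u) features \<Rightarrow> real \<Rightarrow> bool"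
where
  "mpfqi_input X U n p S \<gamma> f \<epsilon> \<longleftrightarrow>
     1 \<le> n \<and> 1 \<le> p \<and> 0 < \<gamma> \<and> \<gamma> < 1 \<and> 0 < \<epsilon> \<and>
     length S = n \<and> (\<forall>(z, x', r) \<in> set S. z \<in> X \<times> U \<and> x' \<in> X) \<and>
     (\<forall>j<p. \<forall>z \<in> X \<times> U. f j z \<noteq> \<infinity>) \<and>
     (\<forall>j<p. \<forall>(z, x', r) \<in> set S. \<exists>u\<in>U. \<forall>v\<in>U. f j (x', v) \<le> f j (x', u))"

definition bellman_s :: "'u set \<Rightarrow> real \<Rightarrow> ('x \<times> 'u \<Rightarrow> ereal) \<Rightarrow> ('x, 'u) sample \<Rightarrow> ereal" where
  "bellman_s U \<gamma> Q = (\<lambda>(z, x', r). ereal r \<boxplus> ereal \<gamma> * max_action U Q x')"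

definition Fs :: "nat \<Rightarrow> ('x, 'u) sample list \<Rightarrow> ('x, 'u) features \<Rightarrow> mmat" where
  "Fs p S f = map (\<lambda>(z, x', r). map (\<lambda>j. f j z) [0..<p]) S"

definition Gs :: "'u set \<Rightarrow> nat \<Rightarrow> ('x, 'u) sample list \<Rightarrow> real \<Rightarrow> ('x, 'u) features \<Rightarrow> mmat" where
  "Gs U p S \<gamma> f = map (\<lambda>s. map (\<lambda>j. bellman_s U \<gamma> (f j) s) [0..<p]) S"

definition compileT ::
  "'u set \<Rightarrow> nat \<Rightarrow> ('x, 'u) sample list \<Rightarrow> real \<Rightarrow> ('x, 'u) features \<Rightarrow> (mmat \<times> mmat) timed"
where
  "compileT U p S \<gamma> f = do {
     F \<leftarrow> mapT (\<lambda>(z, x', r). mapT (\<lambda>j. elem (f j z)) [0..<p]) S;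
     G \<leftarrow> mapT (\<lambda>(z, x', r). mapT (\<lambda>j. do {
            m \<leftarrow> elem (max_action U (f j) x');
            d \<leftarrow> elem (ereal \<gamma> * m);
            elem (ereal r \<boxplus> d) }) [0..<p]) S;
     ret (F, G) }"

definition opD :: "real \<Rightarrow> mmat \<Rightarrow> mmat \<Rightarrow> mvec \<Rightarrow> mvec" where
  "opD \<gamma> F G \<theta> =
     map uminus (List.transpose F \<boxtimes> map uminus (G \<boxtimes> map (\<lambda>t. ereal \<gamma> * t) \<theta>))"

definition opDT :: "real \<Rightarrow> mmat \<Rightarrow> mmat \<Rightarrow> mvec \<Rightarrow> mvec timed" where
  "opDT \<gamma> F G \<theta> = do {
     d \<leftarrow> mapT (\<lambda>t. elem (ereal \<gamma> * t)) \<theta>;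
     y \<leftarrow> mp_multT G d;
     w \<leftarrow> mapT (\<lambda>t. elem (- t)) y;
     v \<leftarrow> mp_multT (List.transpose F) w;
     mapT (\<lambda>t. elem (- t)) v }"

definition sup_dist :: "mvec \<Rightarrow> mvec \<Rightarrow> ereal" where
  "sup_dist a b = (MAX j\<in>{..<length b}. \<bar>a ! j \<boxplus> - (b ! j)\<bar>)"

definition sup_distT :: "mvec \<Rightarrow> mvec \<Rightarrow> ereal timed" where
  "sup_distT a b = do {
     ds \<leftarrow> mapT (\<lambda>(x, y). do {
             y' \<leftarrow> elem (- y);
             d \<leftarrow> elem (x \<boxplus> y');
             d' \<leftarrow> elem (- d);
             elem (max d d') }) (zip a b);
     maxT ds }"

text \<open>The state of the loop is the pair \<open>(\<theta>, \<theta>\<^sup>+)\<close>.\<close>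

type_synonym state = "mvec \<times> mvec"

definition initT :: "real \<Rightarrow> mmat \<Rightarrow> mmat \<Rightarrow> nat \<Rightarrow> state timed" where
  "initT \<gamma> F G p = do {
     \<theta>' \<leftarrow> opDT \<gamma> F G (replicate p 0);
     ret (replicate p 0, \<theta>') }"

text \<open>
  One iteration, including the evaluation of the termination test; the result is \<open>None\<close> if the
  loop is left.
\<close>

definition iterT :: "real \<Rightarrow> real \<Rightarrow> mmat \<Rightarrow> mmat \<Rightarrow> state \<Rightarrow> state option timed" where
  "iterT \<gamma> \<epsilon> F G = (\<lambda>(\<theta>, \<theta>'). do {
     d \<leftarrow> sup_distT \<theta>' \<theta>;
     b \<leftarrow> elem (d > ereal \<epsilon>);
     if b then do { \<theta>'' \<leftarrow> opDT \<gamma> F G \<theta>'; ret (Some (\<theta>', \<theta>'')) } else ret None })"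

inductive loop_state :: "real \<Rightarrow> real \<Rightarrow> mmat \<Rightarrow> mmat \<Rightarrow> nat \<Rightarrow> state \<Rightarrow> bool"
  for \<gamma> \<epsilon> F G p
where
  "loop_state \<gamma> \<epsilon> F G p (val (initT \<gamma> F G p))"
| "loop_state \<gamma> \<epsilon> F G p s \<Longrightarrow> val (iterT \<gamma> \<epsilon> F G s) = Some s' \<Longrightarrow> loop_state \<gamma> \<epsilon> F G p s'"

section \<open>The counted programs compute the intended values\<close>

lemma val_simps [simp]:
  "val (ret x) = x" "val (elem x) = x" "val (bind_timed m k) = val (k (val m))"
  by (simp_all add: ret_def elem_def bind_timed_def)

lemma val_mapT [simp]: "val (mapT g xs) = map (\<lambda>x. val (g x)) xs"
  by (induction xs) simp_all

lemma val_maxT: "xs \<noteq> [] \<Longrightarrow> val (maxT xs) = Max (set xs)"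
  by (induction xs rule: maxT.induct) simp_all

lemma val_compileT: "val (compileT U p S \<gamma> f) = (Fs p S f, Gs U p S \<gamma> f)"
  by (auto simp: compileT_def Fs_def Gs_def bellman_s_def split: prod.splits)

lemma map_zip_image:
  assumes "length a = length b"
  shows "set (map (\<lambda>(x, y). h x y) (zip a b)) = (\<lambda>k. h (a ! k) (b ! k)) ` {..<length b}"
  using assms by (auto simp: set_zip image_iff)

lemma val_mp_multT:
  assumes "v \<noteq> []" and "\<And>a. a \<in> set A \<Longrightarrow> length a = length v"
  shows "val (mp_multT A v) = A \<boxtimes> v"
proof -
  have "val (maxT (map (\<lambda>(x, y). x \<boxplus> y) (zip a v))) = (MAX k\<in>{..<length v}. a ! k \<boxplus> v ! k)"
    if "a \<in> set A" for a
  proof -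
    have "zip a v \<noteq> []" using assms that by (cases a; cases v; force)
    then show ?thesis using map_zip_image[of a v "(\<boxplus>)"] assms that by (simp add: val_maxT)
  qed
  then show ?thesis by (simp add: mp_multT_def mp_mult_def case_prod_unfold)
qed

lemma val_opDT:
  assumes "\<theta> \<noteq> []" "F \<noteq> []" "length G = length F"
    and "\<And>a. a \<in> set F \<Longrightarrow> length a = length \<theta>" "\<And>a. a \<in> set G \<Longrightarrow> length a = length \<theta>"
  shows "val (opDT \<gamma> F G \<theta>) = opD \<gamma> F G \<theta>"
proof -
  let ?d = "map (\<lambda>t. ereal \<gamma> * t) \<theta>"
  have G: "val (mp_multT G ?d) = G \<boxtimes> ?d"
    using assms by (intro val_mp_multT) auto
  have len: "length (G \<boxtimes> ?d) = length F" using assms by (simp add: mp_mult_def)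
  have "length a = length F" if a: "a \<in> set (List.transpose F)" for a
  proof -
    obtain j where j: "j < length (List.transpose F)" "a = List.transpose F ! j"
      using a by (auto simp: in_set_conv_nth)
    have "length (List.transpose F) = length \<theta>"
      using transpose_rectangle[of F "length \<theta>"] assms by auto
    then have "a = map (\<lambda>i. F ! i ! j) [0..<length F]"
      using transpose_rectangle[of F "length \<theta>"] assms j by auto
    then show ?thesis by simp
  qed
  then have "val (mp_multT (List.transpose F) (map uminus (G \<boxtimes> ?d))) =
      List.transpose F \<boxtimes> map uminus (G \<boxtimes> ?d)"
    using len assms by (intro val_mp_multT) auto
  then show ?thesis using G by (simp add: opDT_def opD_def)
qed

lemma val_sup_distT:
  assumes "b \<noteq> []" "length a = length b"
  shows "val (sup_distT a b) = sup_dist a b"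
proof -
  have abs: "max x (- x) = \<bar>x\<bar>" for x :: ereal
    by (cases x) (auto simp: max_def)
  have "zip a b \<noteq> []" using assms by (cases a; cases b; force)
  then show ?thesis
    using map_zip_image[of a b "\<lambda>x y. \<bar>x \<boxplus> - y\<bar>"] assms
    by (simp add: sup_distT_def sup_dist_def val_maxT abs case_prod_unfold)
qed

end

theory Submission
  imports Defs
begin

text \<open>
  Each counted program is a composition of maps over lists, so its cost is a sum of costs of the
  entries. Compilation charges one operation per entry of the first matrix and three per entry of
  the second, hence exactly \<open>4 n p\<close> operations. A max-plus product of a matrix with \<open>l\<close> rows and a
  vector of length \<open>m\<close> charges at most \<open>2 l m\<close>: \<open>m\<close> sums and \<open>m - 1\<close> comparisons per row.

  Every iterate has length \<open>p\<close>: the initial parameter does by construction, and the output of the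
  operator \<open>opDT\<close> always has as many entries as \<open>F\<close> has columns. One iteration therefore consists
  of two products costing at most \<open>2 n p\<close> each and of work linear in \<open>n\<close> and \<open>p\<close> (scaling,
  negations, and the termination test), in total at most \<open>4 n p + n + 7 p + 1\<close>. As
  \<open>n\<close> and \<open>p\<close> are at least 1, this is at most \<open>13 n p\<close>.
\<close>

lemma cost_simps [simp]:
  "cost (ret x) = 0" "cost (elem x) = 1" "cost (bind_timed m k) = cost m + cost (k (val m))"
  by (simp_all add: ret_def elem_def bind_timed_def)

lemma cost_mapT_const: "(\<And>x. x \<in> set xs \<Longrightarrow> cost (g x) = c) \<Longrightarrow> cost (mapT g xs) = length xs * c"
  by (induction xs) simp_all

lemma cost_mapT_le: "(\<And>x. x \<in> set xs \<Longrightarrow> cost (g x) \<le> c) \<Longrightarrow> cost (mapT g xs) \<le> length xs * c"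
  by (induction xs) (auto intro: add_mono)

lemma cost_maxT: "cost (maxT xs) = length xs - 1"
  by (induction xs rule: maxT.induct) simp_all

lemma cost_compileT: "cost (compileT U p S \<gamma> f) = 4 * (length S * p)"
proof -
  have F: "cost (mapT (\<lambda>(z, x', r). mapT (\<lambda>j. elem (f j z)) [0..<p]) S) = length S * p"
    by (rule cost_mapT_const) (simp add: cost_mapT_const[where c = 1] split: prod.splits)
  have G: "cost (mapT (\<lambda>(z, x', r). mapT (\<lambda>j. do {
            m \<leftarrow> elem (max_action U (f j) x');
            d \<leftarrow> elem (ereal \<gamma> * m);
            elem (ereal r \<boxplus> d) }) [0..<p]) S) = length S * (p * 3)"
    by (rule cost_mapT_const) (simp add: cost_mapT_const[where c = 3] split: prod.splits)
  show ?thesis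
    by (simp add: compileT_def F G)
qed

lemma cost_mp_multT_le: "cost (mp_multT A v) \<le> length A * (2 * length v)"
  unfolding mp_multT_def
  by (rule cost_mapT_le) (simp add: cost_maxT cost_mapT_const[where c = 1] case_prod_unfold)

lemma length_val_mp_multT [simp]: "length (val (mp_multT A v)) = length A"
  by (simp add: mp_multT_def)

lemma length_val_opDT [simp]: "length (val (opDT \<gamma> F G \<theta>)) = length (List.transpose F)"
  by (simp add: opDT_def)

lemma cost_opDT_le:
  "cost (opDT \<gamma> F G \<theta>) \<le>
     length \<theta> + length G * (2 * length \<theta>) + length G +
     length (List.transpose F) * (2 * length G) + length (List.transpose F)"
proof -
  let ?d = "map (\<lambda>t. ereal \<gamma> * t) \<theta>"
  let ?w = "map uminus (val (mp_multT G ?d))"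
  have "cost (mp_multT G ?d) \<le> length G * (2 * length \<theta>)"
    using cost_mp_multT_le[of G ?d] by simp
  moreover have "cost (mp_multT (List.transpose F) ?w) \<le> length (List.transpose F) * (2 * length G)"
    using cost_mp_multT_le[of "List.transpose F" ?w] by simp
  ultimately show ?thesis
    by (simp add: opDT_def cost_mapT_const[where c = 1])
qed

lemma cost_sup_distT_le: "cost (sup_distT a b) \<le> 5 * length b"
  by (simp add: sup_distT_def cost_maxT cost_mapT_const[where c = 4] case_prod_unfold)

lemma cost_iterT_le:
  "cost (iterT \<gamma> \<epsilon> F G (\<theta>, \<theta>')) \<le> 5 * length \<theta> + 1 + cost (opDT \<gamma> F G \<theta>')"
  using cost_sup_distT_le[of \<theta>' \<theta>] by (simp add: iterT_def)

lemma loop_state_length: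
  assumes "loop_state \<gamma> \<epsilon> F G p s" and "length (List.transpose F) = p"
  shows "length (fst s) = p" and "length (snd s) = p"
proof -
  have "length (fst s) = p \<and> length (snd s) = p"
    using assms
    by (induction rule: loop_state.induct)
      (auto simp: initT_def iterT_def split: prod.splits if_splits)
  then show "length (fst s) = p" and "length (snd s) = p" by auto
qed

text \<open>
  The transpose of a list of rows has as many rows as its longest row has entries, so an empty
  sample list has to be excluded.
\<close>

lemma length_transpose_Fs: "S \<noteq> [] \<Longrightarrow> length (List.transpose (Fs p S f)) = p"
  using transpose_rectangle[of "Fs p S f" p]
  by (auto simp: Fs_def split: prod.splits)

theorem theorem3p5:
  fixes X :: "(real ^ 'dx) set" and U :: "(real ^ 'du) set"
  assumes "X \<noteq> {}" and "U \<noteq> {}"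
  shows
    "(\<exists>C>0. \<forall>n p S \<gamma> f \<epsilon>. mpfqi_input X U n p S \<gamma> f \<epsilon> \<longrightarrow>
        real (cost (compileT U p S \<gamma> f)) \<le> C * (real n * real p)) \<and>
     (\<exists>C>0. \<forall>n p S \<gamma> f \<epsilon>. mpfqi_input X U n p S \<gamma> f \<epsilon> \<longrightarrow>
        (\<forall>F G s. (F, G) = val (compileT U p S \<gamma> f) \<longrightarrow> loop_state \<gamma> \<epsilon> F G p s \<longrightarrow>
          real (cost (iterT \<gamma> \<epsilon> F G s)) \<le> C * (real n * real p)))"
proof (intro conjI)
  show "\<exists>C>0. \<forall>n p S \<gamma> f \<epsilon>. mpfqi_input X U n p S \<gamma> f \<epsilon> \<longrightarrow>
      real (cost (compileT U p S \<gamma> f)) \<le> C * (real n * real p)"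
    by (intro exI[of _ 4]) (auto simp: mpfqi_input_def cost_compileT)
next
  have "real (cost (iterT \<gamma> \<epsilon> F G s)) \<le> 13 * (real n * real p)"
    if input: "mpfqi_input X U n p S \<gamma> f \<epsilon>"
      and FG: "(F, G) = val (compileT U p S \<gamma> f)"
      and s: "loop_state \<gamma> \<epsilon> F G p s"
    for n p S \<gamma> f \<epsilon> F G s
  proof -
    have n: "1 \<le> n" and p: "1 \<le> p" and S: "length S = n"
      using input by (auto simp: mpfqi_input_def)
    have F: "length (List.transpose F) = p" and G: "length G = n"
      using FG n S length_transpose_Fs[of S p f] by (cases S; auto simp: val_compileT Gs_def)+
    obtain \<theta> \<theta>' where s_eq: "s = (\<theta>, \<theta>')" by (cases s)
    have \<theta>: "length \<theta> = p" and \<theta>': "length \<theta>' = p"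
      using loop_state_length[OF s F] s_eq by auto
    have "cost (iterT \<gamma> \<epsilon> F G s) \<le> 4 * (n * p) + n + 7 * p + 1"
      using cost_iterT_le[of \<gamma> \<epsilon> F G \<theta> \<theta>'] cost_opDT_le[of \<gamma> F G \<theta>']
      by (simp add: s_eq \<theta> \<theta>' F G mult_ac)
    moreover have "n \<le> n * p" "p \<le> n * p" "1 \<le> n * p"
      using n p by auto
    ultimately have "cost (iterT \<gamma> \<epsilon> F G s) \<le> 13 * (n * p)"
      by linarith
    then have "real (cost (iterT \<gamma> \<epsilon> F G s)) \<le> real (13 * (n * p))"
      by (rule of_nat_mono)
    then show ?thesis by simp
  qed
  then show "\<exists>C>0. \<forall>n p S \<gamma> f \<epsilon>. mpfqi_input X U n p S \<gamma> f \<epsilon> \<longrightarrow>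
      (\<forall>F G s. (F, G) = val (compileT U p S \<gamma> f) \<longrightarrow> loop_state \<gamma> \<epsilon> F G p s \<longrightarrow>
        real (cost (iterT \<gamma> \<epsilon> F G s)) \<le> C * (real n * real p))"
    by (intro exI[of _ 13]) auto
qed

end
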